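(* Let $(X,\tau,<)$ be a GO-space whose underlying LOTS $(X,\lambda,<)$ has a $\sigma$-closed-discrete dense subset. Then the following are equivalent: (i) $X$ (with the topology $\tau$) has a monotone open locally-finite operator; (ii) $X$ is monotonically metacompact; (iii) $X$ has a monotone open closure-preserving operator; (iv) $X$ has a monotone closure-preserving operator.
   Context: A GO-space $(X,\tau,<)$ is a linearly ordered set $(X,<)$ with a Hausdorff topology $\tau$ having a base of order-convex sets; its underlying LOTS is $(X,\lambda,<)$, where $\lambda$ is the open-interval (order) topology of $<$ (so $\lambda\subseteq\tau$). A subset of a space is $\sigma$-closed-discrete if it is a countable union of closed discrete subsets of that space. A family $\mathcal A$ refines a family $\mathcal B$ if every $A\in\mathcal A$ is contained in some $B\in\mathcal B$. A family $\mathcal F$ of subsets of a space is closure-preserving if $\overline{\bigcup\mathcal H}=\bigcup\{\overline H:H\in\mathcal H\}$ for every $\mathcal H\subseteq\mathcal F$. All operators below are functions $r$ assigning to each open cover $\mathcal U$ of $X$ a cover $r(\mathcal U)$ of $X$ refining $\mathcal U$, such that if $\mathcal U,\mathcal V$ are open covers and $\mathcal U$ refines $\mathcal V$, then $r(\mathcal U)$ refines $r(\mathcal V)$. Such an $r$ is: a monotone open locally-finite operator if every $r(\mathcal U)$ is locally finite and consists of open sets; a monotone closure-preserving operator if every $r(\mathcal U)$ is closure-preserving (with arbitrary sets as members); a monotone open closure-preserving operator if every $r(\mathcal U)$ is closure-preserving and consists of open sets. $X$ is monotonically metacompact if there is such an $r$ for which every $r(\mathcal U)$ is point-finite and consists of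 open sets. *)

theory Defs
  imports "HOL-Analysis.Analysis"
begin

text \<open>The linearly ordered set \<open>(X, <)\<close> is a type of class \<^class>\<open>linorder_topology\<close>. The axiom of
  that class says that the type-class topology \<^const>\<open>open\<close> is the one generated by the open rays,
  so it is the open-interval topology \<open>\<lambda>\<close> of the order and carries no further information. The
  topology \<open>\<tau>\<close> of a GO-space on \<open>X\<close> is a separate object \<open>T\<close> of type \<open>'a topology\<close>.\<close>

abbreviation lots_topology :: "'a::linorder_topology topology"
  where "lots_topology \<equiv> euclidean"

definition order_convex :: "'a::linorder set \<Rightarrow> bool"
  where "order_convex S \<longleftrightarrow> (\<forall>a\<in>S. \<forall>b\<in>S. {a..b} \<subseteq> S)"

definition GO_space :: "'a::linorder topology \<Rightarrow> bool"
  where "GO_space T \<longleftrightarrow>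
    topspace T = UNIV \<and> Hausdorff_space T \<and>
    (\<exists>\<B>. openin T = arbitrary union_of (\<lambda>S. S \<in> \<B>) \<and> (\<forall>S\<in>\<B>. order_convex S))"

definition closed_discrete_in :: "'a topology \<Rightarrow> 'a set \<Rightarrow> bool"
  where "closed_discrete_in T D \<longleftrightarrow>
    closedin T D \<and> subtopology T D = discrete_topology D"

definition sigma_closed_discrete_in :: "'a topology \<Rightarrow> 'a set \<Rightarrow> bool"
  where "sigma_closed_discrete_in T S \<longleftrightarrow>
    (\<exists>\<D>. countable \<D> \<and> (\<forall>D\<in>\<D>. closed_discrete_in T D) \<and> S = \<Union>\<D>)"

definition refines :: "'a set set \<Rightarrow> 'a set set \<Rightarrow> bool"
  where "refines \<A> \<B> \<longleftrightarrow> (\<forall>A\<in>\<A>. \<exists>B\<in>\<B>. A \<subseteq> B)"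

definition open_family :: "'a topology \<Rightarrow> 'a set set \<Rightarrow> bool"
  where "open_family T \<U> \<longleftrightarrow> (\<forall>U\<in>\<U>. openin T U)"

definition open_cover :: "'a topology \<Rightarrow> 'a set set \<Rightarrow> bool"
  where "open_cover T \<U> \<longleftrightarrow> open_family T \<U> \<and> \<Union>\<U> = topspace T"

definition point_finite_in :: "'a topology \<Rightarrow> 'a set set \<Rightarrow> bool"
  where "point_finite_in T \<F> \<longleftrightarrow> (\<forall>x\<in>topspace T. finite {F \<in> \<F>. x \<in> F})"

definition closure_preserving_in :: "'a topology \<Rightarrow> 'a set set \<Rightarrow> bool"
  where "closure_preserving_in T \<F> \<longleftrightarrow>
    (\<forall>\<H>\<subseteq>\<F>. T closure_of (\<Union>\<H>) = (\<Union>H\<in>\<H>. T closure_of H))"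

text \<open>An operator is a total function, but only its values on open covers are constrained.\<close>

definition monotone_operator :: "'a topology \<Rightarrow> ('a set set \<Rightarrow> 'a set set) \<Rightarrow> bool"
  where "monotone_operator T r \<longleftrightarrow>
    (\<forall>\<U>. open_cover T \<U> \<longrightarrow> \<Union>(r \<U>) = topspace T \<and> refines (r \<U>) \<U>) \<and>
    (\<forall>\<U> \<V>. open_cover T \<U> \<and> open_cover T \<V> \<and> refines \<U> \<V> \<longrightarrow> refines (r \<U>) (r \<V>))"

definition monotone_open_locally_finite_operator ::
    "'a topology \<Rightarrow> ('a set set \<Rightarrow> 'a set set) \<Rightarrow> bool"
  where "monotone_open_locally_finite_operator T r \<longleftrightarrow>
    monotone_operator T r \<and>
    (\<forall>\<U>. open_cover T \<U> \<longrightarrow> locally_finite_in T (r \<U>) \<and> open_family T (r \<U>))"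

definition monotone_closure_preserving_operator ::
    "'a topology \<Rightarrow> ('a set set \<Rightarrow> 'a set set) \<Rightarrow> bool"
  where "monotone_closure_preserving_operator T r \<longleftrightarrow>
    monotone_operator T r \<and>
    (\<forall>\<U>. open_cover T \<U> \<longrightarrow> closure_preserving_in T (r \<U>))"

definition monotone_open_closure_preserving_operator ::
    "'a topology \<Rightarrow> ('a set set \<Rightarrow> 'a set set) \<Rightarrow> bool"
  where "monotone_open_closure_preserving_operator T r \<longleftrightarrow>
    monotone_operator T r \<and>
    (\<forall>\<U>. open_cover T \<U> \<longrightarrow> closure_preserving_in T (r \<U>) \<and> open_family T (r \<U>))"

definition monotonically_metacompact :: "'a topology \<Rightarrow> bool"
  where "monotonically_metacompact T \<longleftrightarrow>
    (\<exists>r. monotone_operator T r \<and>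
      (\<forall>\<U>. open_cover T \<U> \<longrightarrow> point_finite_in T (r \<U>) \<and> open_family T (r \<U>)))"

end

theory Submission
  imports Defs
begin

text \<open>All four conditions are equivalent to this one: the points that are one-sided in \<open>T\<close> without being
  isolated lie in a \<open>\<sigma>\<close>-closed-discrete set.

  Necessity: given an operator \<open>r\<close> and a right-sided point \<open>a\<close>, apply \<open>r\<close> to the clopen cover
  \<open>{(\<leftarrow>,a), [a,\<rightarrow>)}\<close>. Some interval to the right of \<open>a\<close> consists of points \<open>q\<close> lying in a member \<open>H\<close>
  with \<open>a\<close> in its closure. Group the points \<open>a\<close> by a closed discrete set \<open>D\<^sub>n\<close> that meets this
  interval. If \<open>a\<close> were a limit from the right of a set \<open>F\<close> of points of its own group, then a
  single \<open>q > a\<close> would serve all of \<open>F\<close>. By monotonicity, applied to the union of the covers for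
  \<open>F\<close>, the point \<open>a\<close> would lie in the closure of the union of the members containing \<open>q\<close>, hence in
  the closure of one of them; but each of these is contained in some \<open>[b,\<rightarrow>)\<close> with \<open>b \<in> F\<close>, \<open>b > a\<close>.

  Sufficiency: let \<open>D\<^sub>n\<close> increase to a dense set containing the one-sided points. The cell
  of \<open>x\<close> at level \<open>n\<close> is the convex component of \<open>x\<close> in the complement of \<open>D\<^sub>n - {x}\<close>, cut at \<open>x\<close> if
  \<open>x\<close> is a one-sided point of \<open>D\<^sub>n\<close>. An open cover is sent to the family of the first cells of the
  points that are contained in a member.\<close>

section \<open>Locally subsingleton sets\<close>

text \<open>In a \<open>T\<^sub>1\<close> space this means closed and discrete, in a form that passes at once to finer
  topologies.\<close>

definition locally_subsingleton_in :: "'a topology \<Rightarrow> 'a set \<Rightarrow> bool"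
  where "locally_subsingleton_in T S \<longleftrightarrow>
    (\<forall>x\<in>topspace T. \<exists>V. openin T V \<and> x \<in> V \<and> V \<inter> S \<subseteq> {x})"

lemma closed_discrete_in_imp_locally_subsingleton_in:
  assumes "closed_discrete_in T S"
  shows "locally_subsingleton_in T S"
  unfolding locally_subsingleton_in_def
proof
  fix x assume x: "x \<in> topspace T"
  have cl: "closedin T S" and sub: "subtopology T S = discrete_topology S"
    using assms unfolding closed_discrete_in_def by auto
  show "\<exists>V. openin T V \<and> x \<in> V \<and> V \<inter> S \<subseteq> {x}"
  proof (cases "x \<in> S")
    case True
    then have "openin (subtopology T S) {x}"
      by (simp add: sub)
    then obtain V where "openin T V" "{x} = V \<inter> S"
      unfolding openin_subtopology by blast
    then show ?thesis by blast
  next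
    case False
    then have "openin T (topspace T - S) \<and> x \<in> topspace T - S \<and> (topspace T - S) \<inter> S \<subseteq> {x}"
      using cl x by (auto simp: openin_diff)
    then show ?thesis by blast
  qed
qed

lemma locally_subsingleton_in_Un:
  assumes "locally_subsingleton_in T S" "locally_subsingleton_in T S'"
  shows "locally_subsingleton_in T (S \<union> S')"
  unfolding locally_subsingleton_in_def
proof
  fix x assume "x \<in> topspace T"
  then obtain V V' where "openin T V" "x \<in> V" "V \<inter> S \<subseteq> {x}"
    "openin T V'" "x \<in> V'" "V' \<inter> S' \<subseteq> {x}"
    using assms unfolding locally_subsingleton_in_def by meson
  then have "openin T (V \<inter> V') \<and> x \<in> V \<inter> V' \<and> (V \<inter> V') \<inter> (S \<union> S') \<subseteq> {x}"
    by auto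
  then show "\<exists>V. openin T V \<and> x \<in> V \<and> V \<inter> (S \<union> S') \<subseteq> {x}" by blast
qed

lemma locally_subsingleton_in_UN_atMost:
  fixes S :: "nat \<Rightarrow> 'a set"
  assumes "\<And>n. locally_subsingleton_in T (S n)"
  shows "locally_subsingleton_in T (\<Union>i\<le>n. S i)"
proof (induction n)
  case 0
  then show ?case using assms by simp
next
  case (Suc n)
  then show ?case
    using locally_subsingleton_in_Un[OF assms Suc.IH] by (simp add: atMost_Suc)
qed

text \<open>Applied with \<open>id\<close> to sets that have at most one point, and with
  \<open>cell n\<close> to points that all share one cell.\<close>

lemma finite_image_if_constant:
  assumes "\<And>x y. x \<in> S \<Longrightarrow> y \<in> S \<Longrightarrow> f x = f y"
  shows "finite (f ` S)"
proof (cases "S = {}")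
  case False
  then obtain a where "a \<in> S" by blast
  then have "f ` S \<subseteq> {f a}" using assms by blast
  then show ?thesis using finite_subset by blast
qed simp

section \<open>Controlled covers\<close>

text \<open>The common consequence of closure preservation and of point-finiteness with open members that
  the necessity argument uses.\<close>

definition locally_controlled_in :: "'a topology \<Rightarrow> 'a set set \<Rightarrow> bool"
  where "locally_controlled_in T \<F> \<longleftrightarrow>
    (\<forall>a\<in>topspace T. \<exists>V. openin T V \<and> a \<in> V \<and> (\<forall>d\<in>V. \<exists>H\<in>\<F>. d \<in> H \<and> a \<in> T closure_of H)) \<and>
    (\<forall>a\<in>topspace T. \<forall>e\<in>topspace T. a \<in> T closure_of (\<Union>{H \<in> \<F>. e \<in> H}) \<longrightarrow>
       (\<exists>H\<in>\<F>. e \<in> H \<and> a \<in> T closure_of H))"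

lemma locally_controlled_in_nbhd:
  assumes "locally_controlled_in T \<F>" "a \<in> topspace T"
  shows "\<exists>V. openin T V \<and> a \<in> V \<and> (\<forall>d\<in>V. \<exists>H\<in>\<F>. d \<in> H \<and> a \<in> T closure_of H)"
  using assms unfolding locally_controlled_in_def by simp

lemma locally_controlled_in_star:
  assumes "locally_controlled_in T \<F>" "e \<in> topspace T"
    and "a \<in> T closure_of (\<Union>{H \<in> \<F>. e \<in> H})"
  shows "\<exists>H\<in>\<F>. e \<in> H \<and> a \<in> T closure_of H"
proof -
  have "a \<in> topspace T" using assms(3) by (simp add: in_closure_of)
  then show ?thesis using assms unfolding locally_controlled_in_def by simp
qed

text \<open>The members whose closure misses \<open>a\<close> have a union whose closure misses
  \<open>a\<close> too, and the complement of that closure is the neighbourhood sought. As members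
  need not be open, \<open>a\<close> is found only in the closure of \<open>H\<close>.\<close>

lemma closure_preserving_cover_locally_controlled:
  assumes cp: "closure_preserving_in T \<F>" and cover: "\<Union>\<F> = topspace T"
  shows "locally_controlled_in T \<F>"
  unfolding locally_controlled_in_def
proof (intro conjI ballI impI)
  fix a assume a: "a \<in> topspace T"
  let ?\<H> = "{H \<in> \<F>. a \<notin> T closure_of H}"
  have eq: "T closure_of (\<Union>?\<H>) = (\<Union>H\<in>?\<H>. T closure_of H)"
    by (rule cp[unfolded closure_preserving_in_def, rule_format]) blast
  let ?V = "topspace T - T closure_of (\<Union>?\<H>)"
  have "openin T ?V" by (simp add: openin_diff)
  moreover have "a \<in> ?V" using a unfolding eq by auto
  moreover have "\<exists>H\<in>\<F>. d \<in> H \<and> a \<in> T closure_of H" if "d \<in> ?V" for d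
  proof -
    have "d \<in> \<Union>\<F>" using that unfolding cover by (rule DiffD1)
    then obtain H where H: "H \<in> \<F>" "d \<in> H" by (rule UnionE)
    have "d \<in> T closure_of H" using that H(2) by (auto simp: in_closure_of)
    moreover have "d \<notin> T closure_of H" if "a \<notin> T closure_of H"
      using \<open>d \<in> ?V\<close> H(1) that unfolding eq by auto
    ultimately have "a \<in> T closure_of H" by argo
    then show ?thesis using H by blast
  qed
  ultimately show "\<exists>V. openin T V \<and> a \<in> V \<and> (\<forall>d\<in>V. \<exists>H\<in>\<F>. d \<in> H \<and> a \<in> T closure_of H)"
    by blast
next
  fix a e assume "a \<in> T closure_of (\<Union>{H \<in> \<F>. e \<in> H})"
  moreover have "T closure_of (\<Union>{H \<in> \<F>. e \<in> H}) = (\<Union>H\<in>{H \<in> \<F>. e \<in> H}. T closure_of H)"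
    by (rule cp[unfolded closure_preserving_in_def, rule_format]) blast
  ultimately show "\<exists>H\<in>\<F>. e \<in> H \<and> a \<in> T closure_of H" by auto
qed

text \<open>A single open member around \<open>a\<close> serves as the neighbourhood, and closure
  commutes with the finite union of the members containing \<open>e\<close>.\<close>

lemma point_finite_open_cover_locally_controlled:
  assumes pf: "point_finite_in T \<F>" and op: "open_family T \<F>" and cover: "\<Union>\<F> = topspace T"
  shows "locally_controlled_in T \<F>"
  unfolding locally_controlled_in_def
proof (intro conjI ballI impI)
  fix a assume a: "a \<in> topspace T"
  then obtain H where H: "H \<in> \<F>" "a \<in> H" using cover by blast
  then have "openin T H" "a \<in> T closure_of H"
    using op a by (auto simp: open_family_def in_closure_of)
  then show "\<exists>V. openin T V \<and> a \<in> V \<and> (\<forall>d\<in>V. \<exists>H\<in>\<F>. d \<in> H \<and> a \<in> T closure_of H)"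
    using H by blast
next
  fix a e assume "a \<in> T closure_of (\<Union>{H \<in> \<F>. e \<in> H})" "e \<in> topspace T"
  moreover have "finite {H \<in> \<F>. e \<in> H}"
    using pf \<open>e \<in> topspace T\<close> unfolding point_finite_in_def by blast
  ultimately show "\<exists>H\<in>\<F>. e \<in> H \<and> a \<in> T closure_of H"
    by (auto simp: closure_of_Union)
qed

section \<open>Ordered spaces with a tower of sets, and limits from the right\<close>

text \<open>The order is a locale parameter so that every result can be applied to the reversed order.\<close>

locale GO_tower = linorder less_eq less
  for less_eq :: "'a \<Rightarrow> 'a \<Rightarrow> bool" (infix "\<sqsubseteq>" 50) and less (infix "\<sqsubset>" 50) +
  fixes T :: "'a topology" and D :: "nat \<Rightarrow> 'a set"
  assumes topspace_UNIV: "topspace T = UNIV"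
    and openin_above: "openin T {y. x \<sqsubset> y}"
    and openin_below: "openin T {y. y \<sqsubset> x}"
    and convex_nbhd: "\<lbrakk>openin T U; x \<in> U\<rbrakk> \<Longrightarrow> \<exists>V. openin T V \<and> x \<in> V \<and> V \<subseteq> U \<and>
      (\<forall>a\<in>V. \<forall>b\<in>V. \<forall>c. a \<sqsubseteq> c \<and> c \<sqsubseteq> b \<longrightarrow> c \<in> V)"
    and locally_subsingleton: "locally_subsingleton_in T (D n)"
    and dense: "\<lbrakk>a \<sqsubset> c; c \<sqsubset> b\<rbrakk> \<Longrightarrow> \<exists>n. \<exists>d\<in>D n. a \<sqsubset> d \<and> d \<sqsubset> b"
begin

lemma dual: "GO_tower (\<lambda>x y. y \<sqsubseteq> x) (\<lambda>x y. y \<sqsubset> x) T D"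
  apply (intro GO_tower.intro dual_linorder GO_tower_axioms.intro)
  subgoal by (rule topspace_UNIV)
  subgoal by (rule openin_below)
  subgoal by (rule openin_above)
  subgoal using convex_nbhd by meson
  subgoal by (rule locally_subsingleton)
  subgoal using dense by meson
  done

lemma convex_nbhd_subsingleton:
  obtains V where "openin T V" "x \<in> V" "V \<inter> D n \<subseteq> {x}"
    "\<And>a b c. \<lbrakk>a \<in> V; b \<in> V; a \<sqsubseteq> c; c \<sqsubseteq> b\<rbrakk> \<Longrightarrow> c \<in> V"
proof -
  obtain U where U: "openin T U" "x \<in> U" "U \<inter> D n \<subseteq> {x}"
    using locally_subsingleton[of n] unfolding locally_subsingleton_in_def topspace_UNIV by blast
  obtain V where "openin T V" "x \<in> V" "V \<subseteq> U" "\<forall>a\<in>V. \<forall>b\<in>V. \<forall>c. a \<sqsubseteq> c \<and> c \<sqsubseteq> b \<longrightarrow> c \<in> V"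
    using convex_nbhd[OF U(1,2)] by blast
  then show thesis using that[of V] U(3) by blast
qed

lemma closedin_from: "closedin T {y. x \<sqsubseteq> y}"
proof -
  have "{y. x \<sqsubseteq> y} = topspace T - {y. y \<sqsubset> x}" by (auto simp: topspace_UNIV not_less)
  then show ?thesis using openin_below by (metis closedin_diff closedin_topspace)
qed

text \<open>Non-openness of \<open>{y. y \<sqsubseteq> x}\<close> is the working form of being a
  limit from the right. If nothing lay strictly between \<open>x\<close> and \<open>b\<close>, this
  ray would equal the open ray below \<open>b\<close>.\<close>

lemma right_limit_dense:
  assumes "\<not> openin T {y. y \<sqsubseteq> x}" "x \<sqsubset> b"
  shows "\<exists>n. \<exists>d\<in>D n. x \<sqsubset> d \<and> d \<sqsubset> b"
proof -
  have "{y. y \<sqsubseteq> x} \<noteq> {y. y \<sqsubset> b}" using assms openin_below by metis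
  moreover have "{y. y \<sqsubseteq> x} \<subseteq> {y. y \<sqsubset> b}" using assms(2) by (auto intro: le_less_trans)
  ultimately obtain c where "\<not> c \<sqsubseteq> x" "c \<sqsubset> b" by blast
  then have "x \<sqsubset> c" "c \<sqsubset> b" by (simp_all add: not_le)
  then show ?thesis by (rule dense)
qed

text \<open>A neighbourhood of \<open>x\<close> with no point above \<open>x\<close>, joined to the
  open ray below \<open>x\<close>, could make \<open>{y. y \<sqsubseteq> x}\<close> open; so a
  convex one inside \<open>U\<close> must reach to the right.\<close>

lemma right_limit_nbhd:
  assumes nopen: "\<not> openin T {y. y \<sqsubseteq> x}" and U: "openin T U" "x \<in> U"
  shows "\<exists>b. x \<sqsubset> b \<and> (\<forall>y. x \<sqsubseteq> y \<and> y \<sqsubseteq> b \<longrightarrow> y \<in> U)"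
proof -
  obtain V where V: "openin T V" "x \<in> V" "V \<subseteq> U"
    "\<forall>a\<in>V. \<forall>b\<in>V. \<forall>c. a \<sqsubseteq> c \<and> c \<sqsubseteq> b \<longrightarrow> c \<in> V"
    using convex_nbhd[OF U] by blast
  have "\<exists>b\<in>V. x \<sqsubset> b"
  proof (rule ccontr)
    assume "\<not> (\<exists>b\<in>V. x \<sqsubset> b)"
    then have "{y. y \<sqsubseteq> x} = V \<union> {y. y \<sqsubset> x}" using V(2) by (auto simp: not_less le_less)
    then show False using nopen V(1) openin_below by (metis openin_Un)
  qed
  then show ?thesis using V(2-4) by blast
qed

section \<open>Necessity: one-sided points\<close>

text \<open>Each \<open>a\<close> in \<open>S\<close> owns the interval from \<open>a\<close> to
  \<open>e a\<close>, which no other point of \<open>S\<close> enters. Points are grouped by a level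
  \<open>n\<close> at which \<open>D n\<close> meets their interval.\<close>

lemma right_separated_sigma_discrete:
  assumes limit: "\<And>a. a \<in> S \<Longrightarrow> \<not> openin T {y. y \<sqsubseteq> a}"
    and sep: "\<And>a. a \<in> S \<Longrightarrow> \<exists>e. a \<sqsubset> e \<and> (\<forall>b\<in>S. a \<sqsubset> b \<longrightarrow> e \<sqsubseteq> b)"
  shows "\<exists>E :: nat \<Rightarrow> 'a set. (\<forall>n. locally_subsingleton_in T (E n)) \<and> S \<subseteq> (\<Union>n. E n)"
proof -
  obtain e where e: "\<And>a. a \<in> S \<Longrightarrow> a \<sqsubset> e a" "\<And>a b. \<lbrakk>a \<in> S; b \<in> S; a \<sqsubset> b\<rbrakk> \<Longrightarrow> e a \<sqsubseteq> b"
    using sep by metis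
  define E where "E = (\<lambda>n. {a \<in> S. \<exists>d\<in>D n. a \<sqsubset> d \<and> d \<sqsubset> e a})"
  have "locally_subsingleton_in T (E n)" for n
    unfolding locally_subsingleton_in_def
  proof
    fix p assume "p \<in> topspace T"
    obtain V where V: "openin T V" "p \<in> V" "V \<inter> D n \<subseteq> {p}"
      "\<And>a b c. \<lbrakk>a \<in> V; b \<in> V; a \<sqsubseteq> c; c \<sqsubseteq> b\<rbrakk> \<Longrightarrow> c \<in> V"
      by (rule convex_nbhd_subsingleton[of p n]) blast
    \<comment> \<open>The point \<open>d\<close> in the interval owned by \<open>a\<close> lies
      between \<open>a\<close> and \<open>b\<close>, hence in \<open>V\<close>, where only
      \<open>p\<close> can belong to \<open>D n\<close>. So \<open>V\<close> holds at most one point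
      of \<open>E n\<close> on each side of \<open>p\<close>.\<close>
    have between: "a \<sqsubset> p \<and> p \<sqsubset> b" if ab: "a \<in> E n" "b \<in> E n" "a \<in> V" "b \<in> V" "a \<sqsubset> b" for a b
    proof -
      obtain d where d: "d \<in> D n" "a \<sqsubset> d" "d \<sqsubset> e a" using ab(1) unfolding E_def by blast
      have "e a \<sqsubseteq> b" using e(2) ab unfolding E_def by blast
      then have "d \<sqsubset> b" using d(3) by order
      then have "d \<in> V" using V(4)[of a b d] ab d by (simp add: less_imp_le)
      then show ?thesis using V(3) d \<open>d \<sqsubset> b\<close> by blast
    qed
    have "finite (id ` {a \<in> V \<inter> E n. a \<sqsubset> p})" "finite (id ` {a \<in> V \<inter> E n. p \<sqsubset> a})"
      by (rule finite_image_if_constant; simp; metis between less_asym less_linear)+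
    then have "finite ({a \<in> V \<inter> E n. a \<sqsubset> p} \<union> {a \<in> V \<inter> E n. p \<sqsubset> a})" by simp
    moreover have "(V \<inter> E n) - {p} \<subseteq> {a \<in> V \<inter> E n. a \<sqsubset> p} \<union> {a \<in> V \<inter> E n. p \<sqsubset> a}"
      by (auto simp: neq_iff)
    ultimately have fin: "finite ((V \<inter> E n) - {p})" by (rule rev_finite_subset)
    have "closedin T {x}" for x
    proof -
      have "{x} = topspace T - ({y. y \<sqsubset> x} \<union> {y. x \<sqsubset> y})" by (auto simp: topspace_UNIV)
      then show ?thesis
        by (metis closedin_diff closedin_topspace openin_Un openin_above openin_below)
    qed
    then have "closedin T ((V \<inter> E n) - {p})"
      using closedin_Union[of "(\<lambda>x. {x}) ` ((V \<inter> E n) - {p})" T] fin by auto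
    then have "openin T (V - ((V \<inter> E n) - {p}))" using V(1) by (intro openin_diff)
    moreover have "p \<in> V - ((V \<inter> E n) - {p})" "(V - ((V \<inter> E n) - {p})) \<inter> E n \<subseteq> {p}"
      using V(2) by auto
    ultimately show "\<exists>V. openin T V \<and> p \<in> V \<and> V \<inter> E n \<subseteq> {p}" by blast
  qed
  moreover have "S \<subseteq> (\<Union>n. E n)"
  proof
    fix a assume a: "a \<in> S"
    then show "a \<in> (\<Union>n. E n)"
      using right_limit_dense[OF limit e(1), OF a a] unfolding E_def by blast
  qed
  ultimately show ?thesis by blast
qed

lemma right_sided_sigma_discrete:
  assumes mono: "monotone_operator T r"
    and controlled: "\<forall>\<U>. open_cover T \<U> \<longrightarrow> locally_controlled_in T (r \<U>)"
  shows "\<exists>E :: nat \<Rightarrow> 'a set. (\<forall>n. locally_subsingleton_in T (E n)) \<and>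
    {a. openin T {y. a \<sqsubseteq> y} \<and> \<not> openin T {y. y \<sqsubseteq> a}} \<subseteq> (\<Union>n. E n)"
proof -
  define A where "A = {a. openin T {y. a \<sqsubseteq> y} \<and> \<not> openin T {y. y \<sqsubseteq> a}}"
  \<comment> \<open>Every point of \<open>F\<close> contributes a cut just before it. For
    \<open>b\<close> in \<open>F\<close> the family \<open>\<C> {b}\<close> is part of
    \<open>\<C> F\<close>, so monotonicity of \<open>r\<close> can compare them.\<close>
  define \<C> where "\<C> = (\<lambda>F. \<Union>a\<in>F. {{y. y \<sqsubset> a}, {y. a \<sqsubseteq> y}})"
  have cover: "open_cover T (\<C> F)" if "F \<subseteq> A" "F \<noteq> {}" for F
  proof -
    have "open_family T (\<C> F)"
      using that openin_below unfolding open_family_def \<C>_def A_def by auto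
    moreover have "\<Union>(\<C> F) = UNIV"
      using that(2) unfolding \<C>_def by (fastforce simp: not_less)
    ultimately show ?thesis by (simp add: open_cover_def topspace_UNIV)
  qed
  have "\<exists>e. a \<sqsubset> e \<and> (\<forall>d. a \<sqsubset> d \<and> d \<sqsubset> e \<longrightarrow> (\<exists>H\<in>r (\<C> {a}). d \<in> H \<and> a \<in> T closure_of H))"
    if "a \<in> A" for a
  proof -
    have "open_cover T (\<C> {a})" using that by (intro cover) auto
    from locally_controlled_in_nbhd[OF controlled[rule_format, OF this]]
    obtain V where V: "openin T V" "a \<in> V" "\<forall>d\<in>V. \<exists>H\<in>r (\<C> {a}). d \<in> H \<and> a \<in> T closure_of H"
      unfolding topspace_UNIV by blast
    have "\<not> openin T {y. y \<sqsubseteq> a}" using that unfolding A_def by blast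
    from right_limit_nbhd[OF this V(1,2)] V(3) show ?thesis by (meson less_imp_le)
  qed
  then obtain e where e: "\<And>a. a \<in> A \<Longrightarrow> a \<sqsubset> e a"
    "\<And>a d. \<lbrakk>a \<in> A; a \<sqsubset> d; d \<sqsubset> e a\<rbrakk> \<Longrightarrow> \<exists>H\<in>r (\<C> {a}). d \<in> H \<and> a \<in> T closure_of H"
    by metis
  define S where "S = (\<lambda>n. {a \<in> A. \<exists>d\<in>D n. a \<sqsubset> d \<and> d \<sqsubset> e a})"
  have sep: "\<exists>c. a \<sqsubset> c \<and> (\<forall>b\<in>S n. a \<sqsubset> b \<longrightarrow> c \<sqsubseteq> b)" if a: "a \<in> S n" for a n
  proof -
    have aA: "a \<in> A" using a unfolding S_def by blast
    have nopen: "\<not> openin T {y. y \<sqsubseteq> a}" using aA unfolding A_def by blast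
    obtain V where V: "openin T V" "a \<in> V" "V \<inter> D n \<subseteq> {a}"
      "\<And>a b c. \<lbrakk>a \<in> V; b \<in> V; a \<sqsubseteq> c; c \<sqsubseteq> b\<rbrakk> \<Longrightarrow> c \<in> V"
      by (rule convex_nbhd_subsingleton[of a n]) blast
    \<comment> \<open>No point of \<open>D n\<close> lies above \<open>a\<close> and up to
      \<open>q\<close>, so this one \<open>q\<close> can serve every \<open>b\<close> in the set
      \<open>F\<close> below.\<close>
    obtain q where q: "a \<sqsubset> q" "\<forall>y. a \<sqsubseteq> y \<and> y \<sqsubseteq> q \<longrightarrow> y \<in> V"
      using right_limit_nbhd[OF nopen V(1,2)] by blast
    define F where "F = {b \<in> S n. a \<sqsubset> b \<and> b \<sqsubset> q}"
    have FA: "F \<subseteq> A" unfolding F_def S_def by blast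
    show ?thesis
    proof (rule ccontr)
      assume contra: "\<not> ?thesis"
      then have lim: "\<exists>b\<in>S n. a \<sqsubset> b \<and> b \<sqsubset> c" if "a \<sqsubset> c" for c
        using that by (meson not_le)
      have F_lim: "a \<in> T closure_of F"
        unfolding in_closure_of topspace_UNIV
      proof (intro conjI allI impI)
        fix U assume "a \<in> U \<and> openin T U"
        then obtain c where c: "a \<sqsubset> c" "\<forall>y. a \<sqsubseteq> y \<and> y \<sqsubseteq> c \<longrightarrow> y \<in> U"
          using right_limit_nbhd[OF nopen] by blast
        obtain m where m: "a \<sqsubset> m" "m \<sqsubseteq> c" "m \<sqsubseteq> q" using c(1) q(1) linear[of c q] by auto
        from lim[OF m(1)] obtain b where b: "b \<in> S n" "a \<sqsubset> b" "b \<sqsubset> m" by blast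
        then have "b \<sqsubset> q" "b \<sqsubset> c" using m by order+
        then have "b \<in> F" "b \<in> U" unfolding F_def using c(2) b by (auto simp: less_imp_le)
        then show "\<exists>y. y \<in> F \<and> y \<in> U" by blast
      qed simp
      have "F \<noteq> {}" using lim[OF q(1)] unfolding F_def by blast
      note coverF = cover[OF FA this]
      \<comment> \<open>The point of \<open>D n\<close> that puts \<open>b\<close> into
        \<open>S n\<close> must lie beyond \<open>q\<close>, so \<open>q\<close> is between
        \<open>b\<close> and \<open>e b\<close>. The member around \<open>q\<close> obtained from
        \<open>\<C> {b}\<close> is then enlarged to one in \<open>r (\<C> F)\<close>.\<close>
      have "b \<in> T closure_of (\<Union>{H \<in> r (\<C> F). q \<in> H})" if b: "b \<in> F" for b
      proof -
        have bA: "b \<in> A" using b FA by blast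
        obtain d where d: "d \<in> D n" "b \<sqsubset> d" "d \<sqsubset> e b" using b unfolding F_def S_def by blast
        have ab: "a \<sqsubset> b" "b \<sqsubset> q" using b unfolding F_def by auto
        have "q \<sqsubset> d"
        proof (rule ccontr)
          assume "\<not> q \<sqsubset> d"
          then have "d \<in> V" using q(2) ab d(2) by (meson less_imp_le less_trans not_less)
          then show False using V(3) d ab by (metis IntI less_asym singletonD subsetD)
        qed
        then have "q \<sqsubset> e b" using d(3) by order
        then obtain H where H: "H \<in> r (\<C> {b})" "q \<in> H" "b \<in> T closure_of H"
          using e(2)[OF bA ab(2)] by blast
        have "refines (\<C> {b}) (\<C> F)" using b unfolding refines_def \<C>_def by blast
        moreover have "open_cover T (\<C> {b})" using bA by (intro cover) auto
        ultimately have "refines (r (\<C> {b})) (r (\<C> F))"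
          using mono coverF unfolding monotone_operator_def by blast
        then obtain W where W: "W \<in> r (\<C> F)" "H \<subseteq> W" using H(1) unfolding refines_def by blast
        then have "H \<subseteq> \<Union>{H \<in> r (\<C> F). q \<in> H}" using H(2) by blast
        then show ?thesis using H(3) closure_of_mono by blast
      qed
      then have "T closure_of F \<subseteq> T closure_of (\<Union>{H \<in> r (\<C> F). q \<in> H})"
        by (intro closure_of_minimal) auto
      then have "a \<in> T closure_of (\<Union>{H \<in> r (\<C> F). q \<in> H})" using F_lim by blast
      from locally_controlled_in_star[OF controlled[rule_format, OF coverF] _ this]
      obtain W where W: "W \<in> r (\<C> F)" "q \<in> W" "a \<in> T closure_of W"
        unfolding topspace_UNIV by blast
      have "refines (r (\<C> F)) (\<C> F)"
        using mono coverF unfolding monotone_operator_def by blast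
      then obtain b where b: "b \<in> F" "W \<subseteq> {y. y \<sqsubset> b} \<or> W \<subseteq> {y. b \<sqsubseteq> y}"
        using W(1) unfolding refines_def \<C>_def by blast
      \<comment> \<open>Since \<open>W\<close> contains \<open>q\<close>, it lies in the closed ray
        from \<open>b\<close>, and so does its closure; but \<open>a\<close> is below
        \<open>b\<close>.\<close>
      have "\<not> q \<sqsubset> b" using b(1) unfolding F_def by auto
      then have "W \<subseteq> {y. b \<sqsubseteq> y}" using b(2) W(2) by blast
      then have "T closure_of W \<subseteq> {y. b \<sqsubseteq> y}" by (simp add: closure_of_minimal closedin_from)
      then have "b \<sqsubseteq> a" using W(3) by blast
      then show False using b(1) unfolding F_def by auto
    qed
  qed
  have "\<exists>E :: nat \<Rightarrow> 'a set. (\<forall>m. locally_subsingleton_in T (E m)) \<and> S n \<subseteq> (\<Union>m. E m)" for n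
    by (rule right_separated_sigma_discrete) (use sep in \<open>auto simp: S_def A_def\<close>)
  then obtain E :: "nat \<Rightarrow> nat \<Rightarrow> 'a set"
    where E: "\<And>n m. locally_subsingleton_in T (E n m)" "\<And>n. S n \<subseteq> (\<Union>m. E n m)"
    by metis
  have "A \<subseteq> (\<Union>n. S n)"
  proof
    fix a assume a: "a \<in> A"
    then have "\<not> openin T {y. y \<sqsubseteq> a}" unfolding A_def by blast
    from right_limit_dense[OF this e(1)[OF a]] a show "a \<in> (\<Union>n. S n)" unfolding S_def by blast
  qed
  then have "A \<subseteq> (\<Union>k. case prod_decode k of (n, m) \<Rightarrow> E n m)"
    using E(2) by (fastforce intro: exI[of _ "prod_encode _"])
  moreover have "locally_subsingleton_in T (case prod_decode k of (n, m) \<Rightarrow> E n m)" for k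
    using E(1) by (simp split: prod.split)
  ultimately show ?thesis
    unfolding A_def by (intro exI[of _ "\<lambda>k. case prod_decode k of (n, m) \<Rightarrow> E n m"]) blast
qed

end

section \<open>Cells of an increasing tower\<close>

text \<open>Both rays at \<open>x\<close> are open exactly when \<open>x\<close> is isolated, and
  neither is when \<open>x\<close> is a limit from both sides. The inequality in
  \<open>one_sided\<close> thus singles out the one-sided non-isolated points.\<close>

locale exhausting_GO_tower = GO_tower +
  assumes incseq: "m \<le> n \<Longrightarrow> D m \<subseteq> D n"
    and one_sided: "openin T {y. less_eq x y} \<noteq> openin T {y. less_eq y x} \<Longrightarrow> \<exists>n. x \<in> D n"
begin

notation less_eq (infix "\<sqsubseteq>" 50) and less (infix "\<sqsubset>" 50)

text \<open>Separation is tested in both directions, so reversing the order only swaps clauses. An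
  isolated point of \<open>D n\<close> is cut on both sides and has a singleton cell. Points outside
  \<open>D n\<close> are never cut, so that their cells are equal or disjoint.\<close>

definition cell :: "nat \<Rightarrow> 'a \<Rightarrow> 'a set"
  where "cell n x = {y. (\<forall>z\<in>D n. z \<noteq> x \<longrightarrow> \<not> (x \<sqsubseteq> z \<and> z \<sqsubseteq> y) \<and> \<not> (y \<sqsubseteq> z \<and> z \<sqsubseteq> x)) \<and>
    (x \<in> D n \<and> openin T {y. x \<sqsubseteq> y} \<longrightarrow> x \<sqsubseteq> y) \<and>
    (x \<in> D n \<and> openin T {y. y \<sqsubseteq> x} \<longrightarrow> y \<sqsubseteq> x)}"

lemma cellD:
  assumes "y \<in> cell n x" "z \<in> D n" "z \<noteq> x"
  shows "\<not> (x \<sqsubseteq> z \<and> z \<sqsubseteq> y) \<and> \<not> (y \<sqsubseteq> z \<and> z \<sqsubseteq> x)"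
  using assms unfolding cell_def by simp

lemma cell_self: "x \<in> cell n x"
  unfolding cell_def by auto

lemma cell_Int: "cell n x \<inter> D n \<subseteq> {x}"
  unfolding cell_def by (use linear in blast)

lemma cell_antimono: "m \<le> n \<Longrightarrow> cell n x \<subseteq> cell m x"
  using incseq[of m n] unfolding cell_def by blast

lemma openin_cell: "openin T (cell n x)"
proof -
  let ?G = "{y. \<forall>z\<in>D n. z \<noteq> x \<longrightarrow> \<not> (x \<sqsubseteq> z \<and> z \<sqsubseteq> y) \<and> \<not> (y \<sqsubseteq> z \<and> z \<sqsubseteq> x)}"
  let ?R = "if x \<in> D n \<and> openin T {y. x \<sqsubseteq> y} then {y. x \<sqsubseteq> y} else topspace T"
  let ?L = "if x \<in> D n \<and> openin T {y. y \<sqsubseteq> x} then {y. y \<sqsubseteq> x} else topspace T"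
  have "openin T ?G"
  proof (subst openin_subopen, intro ballI)
    fix y assume y: "y \<in> ?G"
    obtain V where V: "openin T V" "y \<in> V" "V \<inter> D n \<subseteq> {y}"
      "\<And>a b c. \<lbrakk>a \<in> V; b \<in> V; a \<sqsubseteq> c; c \<sqsubseteq> b\<rbrakk> \<Longrightarrow> c \<in> V"
      by (rule convex_nbhd_subsingleton[of y n]) blast
    have "v \<in> ?G" if v: "v \<in> V" for v
    proof (rule ccontr)
      assume "v \<notin> ?G"
      then obtain z where z: "z \<in> D n" "z \<noteq> x" "x \<sqsubseteq> z \<and> z \<sqsubseteq> v \<or> v \<sqsubseteq> z \<and> z \<sqsubseteq> x" by blast
      have not: "\<not> (x \<sqsubseteq> z \<and> z \<sqsubseteq> y)" "\<not> (y \<sqsubseteq> z \<and> z \<sqsubseteq> x)" using y z(1,2) by blast+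
      \<comment> \<open>As \<open>z\<close> separates \<open>x\<close> from \<open>v\<close> but not
        from \<open>y\<close>, it lies between \<open>y\<close> and \<open>v\<close>, hence equals
        \<open>y\<close>. But a point of \<open>D n\<close> other than \<open>x\<close> is not in
        \<open>?G\<close>.\<close>
      then have "y \<sqsubseteq> z \<and> z \<sqsubseteq> v \<or> v \<sqsubseteq> z \<and> z \<sqsubseteq> y" using z(3) linear by blast
      then have "z \<in> V" using V(2,4) v by blast
      then have "z = y" using V(3) z(1) by blast
      then show False using not z(3) linear by blast
    qed
    then show "\<exists>V. openin T V \<and> y \<in> V \<and> V \<subseteq> ?G" using V(1,2) by blast
  qed
  then have "openin T (?G \<inter> ?R \<inter> ?L)" by (intro openin_Int) auto
  moreover have "cell n x = ?G \<inter> ?R \<inter> ?L" unfolding cell_def by (auto simp: topspace_UNIV)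
  ultimately show ?thesis by simp
qed

text \<open>As \<open>y\<close> is outside \<open>D n\<close>, the closed interval between
  \<open>y\<close> and \<open>w\<close> contains no point of \<open>D n\<close>. Hence nothing new
  separates \<open>y\<close> from \<open>x\<close>, and if \<open>x\<close> is in
  \<open>D n\<close>, then \<open>y\<close> and \<open>w\<close> lie on the same side of it.\<close>

lemma cell_meets:
  assumes y: "y \<notin> D n" and w: "w \<in> cell n x" "w \<in> cell n y"
  shows "y \<in> cell n x"
proof -
  have wy: "\<not> (y \<sqsubseteq> z \<and> z \<sqsubseteq> w) \<and> \<not> (w \<sqsubseteq> z \<and> z \<sqsubseteq> y)" if "z \<in> D n" for z
    using cellD[OF w(2) that] y that by auto
  have "\<not> (x \<sqsubseteq> z \<and> z \<sqsubseteq> y) \<and> \<not> (y \<sqsubseteq> z \<and> z \<sqsubseteq> x)" if "z \<in> D n" "z \<noteq> x" for z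
    using cellD[OF w(1) that] wy[OF that(1)] linear[of z w] by auto
  moreover have "x \<sqsubseteq> y" if "x \<in> D n" "openin T {y. x \<sqsubseteq> y}"
    using w(1) that wy[OF that(1)] linear[of x y] by (auto simp: cell_def)
  moreover have "y \<sqsubseteq> x" if "x \<in> D n" "openin T {y. y \<sqsubseteq> x}"
    using w(1) that wy[OF that(1)] linear[of x y] by (auto simp: cell_def)
  ultimately show ?thesis by (simp add: cell_def)
qed

lemma cell_subset:
  assumes y: "y \<notin> D n" "y \<in> cell n x"
  shows "cell n y \<subseteq> cell n x"
proof
  fix w assume w: "w \<in> cell n y"
  have wy: "\<not> (y \<sqsubseteq> z \<and> z \<sqsubseteq> w) \<and> \<not> (w \<sqsubseteq> z \<and> z \<sqsubseteq> y)" if "z \<in> D n" for z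
    using cellD[OF w that] y(1) that by auto
  have "\<not> (x \<sqsubseteq> z \<and> z \<sqsubseteq> w) \<and> \<not> (w \<sqsubseteq> z \<and> z \<sqsubseteq> x)" if "z \<in> D n" "z \<noteq> x" for z
    using cellD[OF y(2) that] wy[OF that(1)] linear[of z y] by auto
  moreover have "x \<sqsubseteq> w" if "x \<in> D n" "openin T {y. x \<sqsubseteq> y}"
    using y(2) that wy[OF that(1)] linear[of x w] by (auto simp: cell_def)
  moreover have "w \<sqsubseteq> x" if "x \<in> D n" "openin T {y. y \<sqsubseteq> x}"
    using y(2) that wy[OF that(1)] linear[of x w] by (auto simp: cell_def)
  ultimately show "w \<in> cell n x" by (simp add: cell_def)
qed

lemma cell_eq:
  assumes "y \<notin> D n" "x \<notin> D n" "w \<in> cell n x" "w \<in> cell n y"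
  shows "cell n y = cell n x"
  using assms cell_meets cell_subset by (metis subset_antisym)

text \<open>A point \<open>d\<close> of some \<open>D n\<close>, chosen before the end of an
  interval inside \<open>V\<close>, bounds the cell from above.\<close>

lemma cells_above:
  assumes "openin T V" "x \<in> V" "\<not> openin T {y. y \<sqsubseteq> x}"
  shows "\<exists>n. \<forall>y\<in>cell n x. x \<sqsubseteq> y \<longrightarrow> y \<in> V"
proof -
  obtain b where b: "x \<sqsubset> b" "\<forall>y. x \<sqsubseteq> y \<and> y \<sqsubseteq> b \<longrightarrow> y \<in> V"
    using right_limit_nbhd[OF assms(3,1,2)] by blast
  obtain n d where d: "d \<in> D n" "x \<sqsubset> d" "d \<sqsubset> b"
    using right_limit_dense[OF assms(3) b(1)] by blast
  have "y \<in> V" if "y \<in> cell n x" "x \<sqsubseteq> y" for y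
  proof -
    have "\<not> d \<sqsubseteq> y" using that(1) d(1,2) unfolding cell_def by (auto simp: less_le)
    then have "y \<sqsubseteq> b" using d(3) by order
    then show ?thesis using b(2) that(2) by blast
  qed
  then show ?thesis by blast
qed

lemma exhausting_dual: "exhausting_GO_tower (\<lambda>x y. y \<sqsubseteq> x) (\<lambda>x y. y \<sqsubset> x) T D"
  by (intro exhausting_GO_tower.intro dual exhausting_GO_tower_axioms.intro incseq)
    (use one_sided in auto)

lemma dual_cell: "exhausting_GO_tower.cell (\<lambda>x y. y \<sqsubseteq> x) T D n x = cell n x"
  by (auto simp: exhausting_GO_tower.cell_def[OF exhausting_dual] cell_def)

text \<open>Each side of \<open>x\<close> is treated separately. If \<open>x\<close> is a limit from
  that side, points of the tower shrink the cells there. Otherwise \<open>x\<close>, not being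
  isolated, is one-sided, enters some \<open>D n\<close>, and its cell is cut on that side.\<close>

lemma cells_base:
  assumes nopen: "\<not> openin T {x}" and V: "openin T V" "x \<in> V"
  shows "\<exists>n. cell n x \<subseteq> V"
proof -
  have ray: "\<exists>n. \<forall>y\<in>cell n x. x \<sqsubseteq> y \<longrightarrow> y \<in> V"
    if "\<not> openin T {x}" "openin T V" "x \<in> V" for V
  proof (cases "openin T {y. y \<sqsubseteq> x}")
    case True
    have "{x} = {y. x \<sqsubseteq> y} \<inter> {y. y \<sqsubseteq> x}" by auto
    then have "\<not> openin T {y. x \<sqsubseteq> y}" using True that(1) by (metis openin_Int)
    then obtain n where "x \<in> D n" using one_sided True by blast
    then have "\<forall>y\<in>cell n x. x \<sqsubseteq> y \<longrightarrow> y = x" using True unfolding cell_def by auto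
    then show ?thesis using that(3) by blast
  next
    case False
    then show ?thesis using cells_above that by blast
  qed
  have ray': "\<exists>n. \<forall>y\<in>cell n x. y \<sqsubseteq> x \<longrightarrow> y \<in> V"
  proof (cases "openin T {y. x \<sqsubseteq> y}")
    case True
    have "{x} = {y. x \<sqsubseteq> y} \<inter> {y. y \<sqsubseteq> x}" by auto
    then have "\<not> openin T {y. y \<sqsubseteq> x}" using True nopen by (metis openin_Int)
    then obtain n where "x \<in> D n" using one_sided True by blast
    then have "\<forall>y\<in>cell n x. y \<sqsubseteq> x \<longrightarrow> y = x" using True unfolding cell_def by auto
    then show ?thesis using V(2) by blast
  next
    case False
    then show ?thesis
      using exhausting_GO_tower.cells_above[OF exhausting_dual V] unfolding dual_cell by blast
  qed
  obtain n m where "\<forall>y\<in>cell n x. x \<sqsubseteq> y \<longrightarrow> y \<in> V" "\<forall>y\<in>cell m x. y \<sqsubseteq> x \<longrightarrow> y \<in> V"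
    using ray[OF nopen V] ray' by blast
  moreover have "cell (max n m) x \<subseteq> cell n x" "cell (max n m) x \<subseteq> cell m x"
    by (simp_all add: cell_antimono)
  ultimately have "cell (max n m) x \<subseteq> V" using linear by blast
  then show ?thesis by blast
qed

text \<open>Both counts are needed later: distinct cells for early levels, and indices
  \<open>y\<close> in \<open>D n\<close> for points whose first cell belongs to a later
  level.\<close>

lemma cells_locally_finite:
  "\<exists>W. openin T W \<and> x \<in> W \<and> finite {y \<in> D n. cell n y \<inter> W \<noteq> {}} \<and>
    finite {C \<in> range (cell n). C \<inter> W \<noteq> {}}"
proof -
  obtain W where W: "openin T W" "x \<in> W" "W \<inter> D n \<subseteq> {x}"
    "\<And>a b c. \<lbrakk>a \<in> W; b \<in> W; a \<sqsubseteq> c; c \<sqsubseteq> b\<rbrakk> \<Longrightarrow> c \<in> W"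
    by (rule convex_nbhd_subsingleton[of x n]) blast
  let ?P = "\<lambda>y. y \<in> D n \<and> cell n y \<inter> W \<noteq> {}"
  have outside: "y \<notin> W" if "?P y" "y \<noteq> x" for y
    using that W(3) by blast
  \<comment> \<open>Of two points of \<open>D n\<close> on one side of \<open>x\<close>, the nearer
    one lies outside \<open>W\<close> and blocks the cell of the farther one from reaching
    \<open>W\<close>. So each side has at most one such index.\<close>
  have uniq: False
    if yz: "?P y" "?P z" "y \<sqsubset> z" "y \<noteq> x" "z \<noteq> x" and side: "z \<sqsubset> x \<or> x \<sqsubset> y" for y z
    using side
  proof
    assume "z \<sqsubset> x"
    obtain w where w: "w \<in> cell n y" "w \<in> W" using yz(1) by blast
    have "\<not> w \<sqsubseteq> z"
      using outside[OF yz(2,5)] W(4)[of w x z] w(2) W(2) \<open>z \<sqsubset> x\<close> by (auto simp: less_imp_le)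
    then have "y \<sqsubseteq> z \<and> z \<sqsubseteq> w" using linear yz(3) by (auto simp: less_imp_le)
    then show False using w(1) yz(2,3) unfolding cell_def by auto
  next
    assume "x \<sqsubset> y"
    obtain w where w: "w \<in> cell n z" "w \<in> W" using yz(2) by blast
    have "\<not> y \<sqsubseteq> w"
      using outside[OF yz(1,4)] W(4)[of x w y] w(2) W(2) \<open>x \<sqsubset> y\<close> by (auto simp: less_imp_le)
    then have "w \<sqsubseteq> y \<and> y \<sqsubseteq> z" using linear yz(3) by (auto simp: less_imp_le)
    then show False using w(1) yz(1,3) unfolding cell_def by auto
  qed
  have "finite (id ` {y. ?P y \<and> y \<sqsubset> x})" "finite (id ` {y. ?P y \<and> x \<sqsubset> y})"
    by (rule finite_image_if_constant; simp; metis uniq less_irrefl less_linear)+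
  then have "finite ({x} \<union> {y. ?P y \<and> y \<sqsubset> x} \<union> {y. ?P y \<and> x \<sqsubset> y})" by simp
  moreover have "{y. ?P y} \<subseteq> {x} \<union> {y. ?P y \<and> y \<sqsubset> x} \<union> {y. ?P y \<and> x \<sqsubset> y}"
    by (auto simp: neq_iff)
  ultimately have fin: "finite {y. ?P y}" by (rule rev_finite_subset)
  \<comment> \<open>The only point of \<open>D n\<close> that \<open>W\<close> may contain is
    \<open>x\<close>, so points of \<open>W\<close> on one side of \<open>x\<close> are not
    separated.\<close>
  have same: "cell n v = cell n w"
    if vw: "v \<in> W - D n" "w \<in> W - D n" and side: "v \<sqsubset> x \<and> w \<sqsubset> x \<or> x \<sqsubset> v \<and> x \<sqsubset> w" for v w
  proof -
    have "w \<in> cell n v"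
    proof -
      have "\<not> (v \<sqsubseteq> z \<and> z \<sqsubseteq> w) \<and> \<not> (w \<sqsubseteq> z \<and> z \<sqsubseteq> v)" if "z \<in> D n" for z
      proof -
        have "z \<in> W \<Longrightarrow> z = x" using W(3) that by blast
        moreover have "\<not> (v \<sqsubseteq> x \<and> x \<sqsubseteq> w) \<and> \<not> (w \<sqsubseteq> x \<and> x \<sqsubseteq> v)" using side by auto
        ultimately show ?thesis using W(4)[of v w z] W(4)[of w v z] vw by blast
      qed
      then show ?thesis using vw unfolding cell_def by blast
    qed
    then show ?thesis using cell_eq[of v n w w] vw cell_self by simp
  qed
  have "finite (cell n ` {w \<in> W - D n. w \<sqsubset> x})" "finite (cell n ` {w \<in> W - D n. x \<sqsubset> w})"
    by (rule finite_image_if_constant; use same in blast)+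
  then have "finite (cell n ` {y. ?P y} \<union> {cell n x} \<union> cell n ` {w \<in> W - D n. w \<sqsubset> x} \<union>
      cell n ` {w \<in> W - D n. x \<sqsubset> w})" (is "finite ?R")
    using fin by simp
  moreover have "{C \<in> range (cell n). C \<inter> W \<noteq> {}} \<subseteq> ?R"
  proof
    fix C assume "C \<in> {C \<in> range (cell n). C \<inter> W \<noteq> {}}"
    then obtain y w where y: "C = cell n y" "w \<in> cell n y" "w \<in> W" by blast
    show "C \<in> ?R"
    proof (cases "y \<in> D n")
      case True
      then show ?thesis using y by blast
    next
      case False
      then have w: "w \<notin> D n" using y(2) cell_Int by blast
      then have "C = cell n w" using cell_eq[of y n w w] False y(1,2) cell_self by simp
      then show ?thesis using w y(3) less_linear[of w x] by blast
    qed
  qed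
  ultimately have "finite {C \<in> range (cell n). C \<inter> W \<noteq> {}}" by (rule rev_finite_subset)
  then show ?thesis using fin W(1,2) by blast
qed

section \<open>The operator of first cells\<close>

definition small :: "'a set set \<Rightarrow> 'a \<Rightarrow> nat \<Rightarrow> bool"
  where "small \<U> x n \<longleftrightarrow> (\<exists>U\<in>\<U>. cell n x \<subseteq> U)"

text \<open>Points without a small cell are isolated, and no cell chosen for another point contains them.\<close>

definition first_cell :: "'a set set \<Rightarrow> 'a \<Rightarrow> 'a set"
  where "first_cell \<U> x = (if \<exists>n. small \<U> x n then cell (LEAST n. small \<U> x n) x else {x})"

lemma first_cell_cases:
  obtains k where "small \<U> x k" "\<And>n. small \<U> x n \<Longrightarrow> k \<le> n" "first_cell \<U> x = cell k x"
  | "\<And>n. \<not> small \<U> x n" "first_cell \<U> x = {x}"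
  unfolding first_cell_def by (metis LeastI Least_le)

lemma first_cell_self: "x \<in> first_cell \<U> x"
  by (cases rule: first_cell_cases[of \<U> x]) (auto simp: cell_self)

lemma small_mono: "\<lbrakk>small \<U> x n; y \<notin> D n; y \<in> cell n x\<rbrakk> \<Longrightarrow> small \<U> y n"
  using cell_subset unfolding small_def by blast

text \<open>Refinement is checked at the same index \<open>x\<close>: a coarser cover has a small
  cell of \<open>x\<close> no later, and earlier cells are larger.\<close>

lemma monotone_operator_first_cell: "monotone_operator T (\<lambda>\<U>. range (first_cell \<U>))"
proof -
  have "\<Union>(range (first_cell \<U>)) = topspace T" for \<U>
    using first_cell_self unfolding topspace_UNIV by blast
  moreover have "refines (range (first_cell \<U>)) \<U>" if "open_cover T \<U>" for \<U>
  proof -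
    have "\<exists>U\<in>\<U>. first_cell \<U> x \<subseteq> U" for x
    proof (cases rule: first_cell_cases[of \<U> x])
      case (1 k)
      then show ?thesis unfolding small_def by simp
    next
      case 2
      then show ?thesis using that unfolding open_cover_def topspace_UNIV by auto
    qed
    then show ?thesis unfolding refines_def by blast
  qed
  moreover have "refines (range (first_cell \<U>)) (range (first_cell \<V>))" if "refines \<U> \<V>" for \<U> \<V>
  proof -
    have "first_cell \<U> x \<subseteq> first_cell \<V> x" for x
    proof (cases rule: first_cell_cases[of \<U> x])
      case U: (1 k)
      then have "small \<V> x k" using that unfolding small_def refines_def by (meson subset_trans)
      then show ?thesis
        by (cases rule: first_cell_cases[of \<V> x]) (auto simp: U(3) intro: cell_antimono[THEN subsetD])
    next
      case 2
      then show ?thesis using first_cell_self by simp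
    qed
    then show ?thesis unfolding refines_def by blast
  qed
  ultimately show ?thesis unfolding monotone_operator_def by blast
qed

lemma no_small_imp_isolated:
  assumes "open_cover T \<U>" "\<And>n. \<not> small \<U> x n"
  shows "openin T {x}"
proof (rule ccontr)
  assume nopen: "\<not> openin T {x}"
  have "x \<in> \<Union>\<U>" using assms(1) by (simp add: open_cover_def topspace_UNIV)
  then obtain U where U: "U \<in> \<U>" "x \<in> U" by blast
  then have "openin T U" using assms(1) by (simp add: open_cover_def open_family_def)
  then show False using cells_base[OF nopen _ U(2)] U(1) assms(2) by (auto simp: small_def)
qed

lemma open_family_first_cell:
  assumes "open_cover T \<U>"
  shows "open_family T (range (first_cell \<U>))"
proof -
  have "openin T (first_cell \<U> x)" for x
    by (cases rule: first_cell_cases[of \<U> x])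
      (use no_small_imp_isolated[OF assms] openin_cell in simp_all)
  then show ?thesis unfolding open_family_def by blast
qed

text \<open>First cells of level at most \<open>m\<close> are counted as sets. For any other
  \<open>y\<close> whose first cell meets \<open>W\<close>, the level \<open>m\<close> is not small,
  which forces \<open>y\<close> into \<open>D m\<close>, and such indices are finite in
  number.\<close>

lemma finite_first_cells_at_small:
  assumes small: "small \<U> x m"
  shows "\<exists>W. openin T W \<and> x \<in> W \<and> finite {C \<in> range (first_cell \<U>). C \<inter> W \<noteq> {}}"
proof -
  have "\<forall>n. \<exists>W. openin T W \<and> x \<in> W \<and> finite {y \<in> D n. cell n y \<inter> W \<noteq> {}} \<and>
    finite {C \<in> range (cell n). C \<inter> W \<noteq> {}}"
    using cells_locally_finite by simp
  from choice[OF this] obtain V where "\<forall>n. openin T (V n) \<and> x \<in> V n \<and>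
    finite {y \<in> D n. cell n y \<inter> V n \<noteq> {}} \<and> finite {C \<in> range (cell n). C \<inter> V n \<noteq> {}}"
    by (rule exE)
  then have V: "\<And>n. openin T (V n)" "\<And>n. x \<in> V n"
    "\<And>n. finite {y \<in> D n. cell n y \<inter> V n \<noteq> {}}"
    "\<And>n. finite {C \<in> range (cell n). C \<inter> V n \<noteq> {}}"
    by simp_all
  define W where "W = cell m x \<inter> (\<Inter>n\<in>{..m}. V n)"
  have "openin T W"
    unfolding W_def using V(1) by (intro openin_Int openin_cell openin_INT2) auto
  moreover have "x \<in> W"
    unfolding W_def using V(2) cell_self by blast
  moreover have "{C \<in> range (first_cell \<U>). C \<inter> W \<noteq> {}} \<subseteq>
    (\<Union>n\<in>{..m}. {C \<in> range (cell n). C \<inter> V n \<noteq> {}}) \<union>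
    first_cell \<U> ` {y \<in> D m. cell m y \<inter> V m \<noteq> {}}" (is "_ \<subseteq> ?R")
  proof
    fix C assume "C \<in> {C \<in> range (first_cell \<U>). C \<inter> W \<noteq> {}}"
    then obtain y w where y: "C = first_cell \<U> y" "w \<in> first_cell \<U> y" "w \<in> W" by blast
    \<comment> \<open>The cells of \<open>x\<close> and \<open>y\<close> at level \<open>m\<close>
      share \<open>w\<close>, so \<open>y\<close> lies in the small cell of \<open>x\<close> and
      inherits smallness.\<close>
    have no_small: "small \<U> y m" if "y \<notin> D m" "w \<in> cell m y"
      using small_mono[OF small that(1)] cell_meets[OF that(1) _ that(2), of x] y(3)
      unfolding W_def by blast
    have D: "C \<in> ?R" if "y \<in> D m" "w \<in> cell m y"
    proof -
      have "w \<in> V m" using y(3) unfolding W_def by blast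
      then show ?thesis using that y(1) by blast
    qed
    show "C \<in> ?R"
    proof (cases rule: first_cell_cases[of \<U> y])
      case (1 k)
      show ?thesis
      proof (cases "k \<le> m")
        case True
        then have "w \<in> V k" using y(3) unfolding W_def by blast
        then have "C \<in> {C \<in> range (cell k). C \<inter> V k \<noteq> {}}" using y(1,2) 1(3) by auto
        then show ?thesis using True by blast
      next
        case False
        then have "w \<in> cell m y" using cell_antimono[of m k y] y(2) 1(3) by auto
        then show ?thesis using D no_small 1(2) False by blast
      qed
    next
      case 2
      then have "w \<in> cell m y" using y(2) cell_self by simp
      then show ?thesis using D no_small 2(1) by blast
    qed
  qed
  moreover have "finite ?R" using V(3,4) by blast
  ultimately show ?thesis by (meson finite_subset)
qed

text \<open>If \<open>x\<close> has no small cell, the open set \<open>{x}\<close> is the required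
  neighbourhood. A small cell of another point containing \<open>x\<close> would have
  \<open>x\<close> outside its \<open>D k\<close>, making \<open>x\<close> small at that
  level.\<close>

lemma locally_finite_first_cell:
  assumes cover: "open_cover T \<U>"
  shows "locally_finite_in T (range (first_cell \<U>))"
proof -
  have "\<exists>W. openin T W \<and> x \<in> W \<and> finite {C \<in> range (first_cell \<U>). C \<inter> W \<noteq> {}}" for x
  proof (cases "\<exists>m. small \<U> x m")
    case True
    then show ?thesis using finite_first_cells_at_small by blast
  next
    case False
    have "first_cell \<U> y = {x}" if "x \<in> first_cell \<U> y" for y
    proof (cases rule: first_cell_cases[of \<U> y])
      case (1 k)
      then have "x \<in> cell k y" using that by simp
      then have "x = y"
        using small_mono[OF 1(1)] False cell_Int by blast
      then show ?thesis using 1(1) False by blast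
    next
      case 2
      then show ?thesis using that by simp
    qed
    then have "{C \<in> range (first_cell \<U>). C \<inter> {x} \<noteq> {}} \<subseteq> {{x}}" by auto
    then have "finite {C \<in> range (first_cell \<U>). C \<inter> {x} \<noteq> {}}" using finite_subset by blast
    moreover have "openin T {x}" using no_small_imp_isolated[OF cover] False by blast
    ultimately show ?thesis by blast
  qed
  then show ?thesis
    unfolding locally_finite_in_def by (auto simp: topspace_UNIV)
qed

lemma monotone_open_locally_finite_operator_first_cell:
  "monotone_open_locally_finite_operator T (\<lambda>\<U>. range (first_cell \<U>))"
  unfolding monotone_open_locally_finite_operator_def
  using monotone_operator_first_cell locally_finite_first_cell open_family_first_cell by blast

end

section \<open>Adjoining the one-sided points to the tower\<close>

lemma (in GO_tower) exhausting_GO_tower_if_controlled_operator: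
  assumes mono: "monotone_operator T r"
    and controlled: "\<forall>\<U>. open_cover T \<U> \<longrightarrow> locally_controlled_in T (r \<U>)"
  shows "\<exists>E. exhausting_GO_tower (\<sqsubseteq>) (\<sqsubset>) T E"
proof -
  \<comment> \<open>Neither the topology nor the operator mentions the order, so the reversed order
    supplies the left-sided points.\<close>
  obtain R L :: "nat \<Rightarrow> 'a set" where R: "\<forall>n. locally_subsingleton_in T (R n)"
      "{a. openin T {y. a \<sqsubseteq> y} \<and> \<not> openin T {y. y \<sqsubseteq> a}} \<subseteq> (\<Union>n. R n)"
    and L: "\<forall>n. locally_subsingleton_in T (L n)"
      "{a. openin T {y. y \<sqsubseteq> a} \<and> \<not> openin T {y. a \<sqsubseteq> y}} \<subseteq> (\<Union>n. L n)"
    using right_sided_sigma_discrete[OF assms]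
      GO_tower.right_sided_sigma_discrete[OF dual assms] by (elim exE conjE) blast
  \<comment> \<open>Finite unions make the tower increasing while each level stays locally
    subsingleton.\<close>
  define E where "E = (\<lambda>n. \<Union>i\<le>n. D i \<union> (R i \<union> L i))"
  have sub: "D n \<union> (R n \<union> L n) \<subseteq> E n" for n
    unfolding E_def by blast
  have "exhausting_GO_tower (\<sqsubseteq>) (\<sqsubset>) T E"
  proof (intro exhausting_GO_tower.intro GO_tower.intro GO_tower_axioms.intro
      exhausting_GO_tower_axioms.intro linorder_axioms topspace_UNIV openin_above openin_below)
    show "locally_subsingleton_in T (E n)" for n
      unfolding E_def
      by (intro locally_subsingleton_in_UN_atMost locally_subsingleton_in_Un locally_subsingleton)
        (use R(1) L(1) in simp_all)
    show "\<exists>n. \<exists>d\<in>E n. a \<sqsubset> d \<and> d \<sqsubset> b" if "a \<sqsubset> c" "c \<sqsubset> b" for a b c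
      using dense[OF that] sub by blast
    show "E m \<subseteq> E n" if "m \<le> n" for m n
      unfolding E_def using that by (intro UN_mono) auto
    show "\<exists>n. x \<in> E n" if "openin T {y. x \<sqsubseteq> y} \<noteq> openin T {y. y \<sqsubseteq> x}" for x
    proof -
      have "x \<in> (\<Union>n. R n) \<union> (\<Union>n. L n)" using that R(2) L(2) by auto
      then show ?thesis using sub by blast
    qed
  qed (fact convex_nbhd)
  then show ?thesis by blast
qed

section \<open>Towers in GO-spaces\<close>

lemma GO_space_convex_nbhd:
  assumes "GO_space T" "openin T U" "x \<in> U"
  shows "\<exists>V. openin T V \<and> x \<in> V \<and> V \<subseteq> U \<and> order_convex V"
proof -
  obtain \<B> where \<B>: "openin T = arbitrary union_of (\<lambda>S. S \<in> \<B>)" "\<forall>S\<in>\<B>. order_convex S"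
    using assms(1) unfolding GO_space_def by blast
  obtain \<U> where \<U>: "\<U> \<subseteq> \<B>" "\<Union>\<U> = U"
    using assms(2) unfolding \<B>(1) union_of_def by blast
  then obtain V where V: "V \<in> \<U>" "x \<in> V" using assms(3) by blast
  have "openin T V" unfolding \<B>(1) by (rule arbitrary_union_of_inc) (use V \<U> in blast)
  then show ?thesis using V \<U> \<B>(2) by blast
qed

text \<open>By the Hausdorff property \<open>y\<close> has a convex neighbourhood missing
  \<open>x\<close>, and such a set stays on one side of \<open>x\<close>.\<close>

lemma GO_space_rays:
  assumes go: "GO_space T"
  shows "openin T {y. x < y}" "openin T {y. y < x}"
proof -
  have sep: "\<exists>V. openin T V \<and> y \<in> V \<and> x \<notin> V \<and> order_convex V" if "x \<noteq> y" for y
  proof -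
    have "Hausdorff_space T" "x \<in> topspace T \<and> y \<in> topspace T \<and> x \<noteq> y"
      using go that unfolding GO_space_def by simp_all
    then obtain U V where UV: "openin T V" "x \<in> U" "y \<in> V" "disjnt U V"
      unfolding Hausdorff_space_def by blast
    then have "x \<notin> V" by (auto simp: disjnt_iff)
    then show ?thesis using GO_space_convex_nbhd[OF go UV(1,3)] by blast
  qed
  show "openin T {y. x < y}"
  proof (subst openin_subopen, intro ballI)
    fix y assume "y \<in> {y. x < y}"
    then obtain V where V: "openin T V" "y \<in> V" "x \<notin> V" "order_convex V" using sep[of y] by auto
    have "x < b" if "b \<in> V" for b
    proof (rule ccontr)
      assume "\<not> x < b"
      then have "x \<in> {b..y}" using \<open>y \<in> {y. x < y}\<close> by auto
      then show False using V that unfolding order_convex_def by blast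
    qed
    then show "\<exists>V. openin T V \<and> y \<in> V \<and> V \<subseteq> {y. x < y}" using V by blast
  qed
  show "openin T {y. y < x}"
  proof (subst openin_subopen, intro ballI)
    fix y assume "y \<in> {y. y < x}"
    then obtain V where V: "openin T V" "y \<in> V" "x \<notin> V" "order_convex V" using sep[of y] by auto
    have "b < x" if "b \<in> V" for b
    proof (rule ccontr)
      assume "\<not> b < x"
      then have "x \<in> {y..b}" using \<open>y \<in> {y. y < x}\<close> by auto
      then show False using V that unfolding order_convex_def by blast
    qed
    then show "\<exists>V. openin T V \<and> y \<in> V \<and> V \<subseteq> {y. y < x}" using V by blast
  qed
qed

text \<open>This transfers locally subsingleton sets from the underlying LOTS to
  \<open>T\<close>.\<close>

lemma GO_space_finer:
  fixes T :: "'a::linorder_topology topology"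
  assumes "GO_space T" "open S"
  shows "openin T S"
proof -
  have top: "topspace T = UNIV" using assms(1) unfolding GO_space_def by blast
  have "generate_topology (range (\<lambda>a. {..<a}) \<union> range (\<lambda>a. {a<..})) S"
    using assms(2) by (simp add: open_generated_order)
  then show ?thesis
  proof induction
    case UNIV
    then show ?case using openin_topspace[of T] by (simp add: top)
  next
    case (Basis s)
    then show ?case using GO_space_rays[OF assms(1)] by (auto simp: lessThan_def greaterThan_def)
  qed auto
qed

lemma GO_tower_if_sigma_closed_discrete_dense:
  fixes T :: "'a::linorder_topology topology"
  assumes go: "GO_space T"
    and D: "sigma_closed_discrete_in (lots_topology :: 'a topology) D"
    and dense: "lots_topology closure_of D = topspace lots_topology"
  shows "\<exists>E. GO_tower (\<le>) (<) T E"
proof -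
  obtain \<D> where \<D>: "countable \<D>" "\<forall>S\<in>\<D>. closed_discrete_in (lots_topology :: 'a topology) S" "D = \<Union>\<D>"
    using D unfolding sigma_closed_discrete_in_def by blast
  have cl: "closure D = UNIV" using dense by simp
  \<comment> \<open>Enumerating by \<open>from_nat_into\<close> requires a nonempty family; density
    in a nonempty space provides it.\<close>
  then have "\<D> \<noteq> {}" using \<D>(3) by auto
  then have range: "range (from_nat_into \<D>) = \<D>" using \<D>(1) by (rule range_from_nat_into)
  have "GO_tower (\<le>) (<) T (from_nat_into \<D>)"
  proof (intro GO_tower.intro GO_tower_axioms.intro GO_space_rays[OF go])
    show "class.linorder (\<le>) ((<) :: 'a \<Rightarrow> 'a \<Rightarrow> bool)" by (rule linorder_class.linorder_axioms)
    show "topspace T = UNIV" using go unfolding GO_space_def by blast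
    show "locally_subsingleton_in T (from_nat_into \<D> n)" for n
    proof -
      have "closed_discrete_in (lots_topology :: 'a topology) (from_nat_into \<D> n)"
        using \<D>(2) range by blast
      then have "locally_subsingleton_in (lots_topology :: 'a topology) (from_nat_into \<D> n)"
        by (rule closed_discrete_in_imp_locally_subsingleton_in)
      then show ?thesis
        unfolding locally_subsingleton_in_def using GO_space_finer[OF go]
        by (metis UNIV_I open_openin topspace_euclidean)
    qed
    show "\<exists>V. openin T V \<and> x \<in> V \<and> V \<subseteq> U \<and> (\<forall>a\<in>V. \<forall>b\<in>V. \<forall>c. a \<le> c \<and> c \<le> b \<longrightarrow> c \<in> V)"
      if "openin T U" "x \<in> U" for U x
      using GO_space_convex_nbhd[OF go that] unfolding order_convex_def
      by (meson atLeastAtMost_iff subsetD)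
    show "\<exists>n. \<exists>d\<in>from_nat_into \<D> n. a < d \<and> d < b" if "a < c" "c < b" for a b c
    proof -
      have "c \<in> closure D" "c \<in> {a<..<b}" "open {a<..<b}" using cl that by auto
      then have "D \<inter> {a<..<b} \<noteq> {}" using closure_iff_nhds_not_empty by blast
      then obtain d S where "d \<in> S" "S \<in> \<D>" "a < d" "d < b" using \<D>(3) by auto
      then show ?thesis using range by (metis imageE)
    qed
  qed
  then show ?thesis by blast
qed

section \<open>Equivalence of the four conditions\<close>

lemma closure_preserving_in_if_locally_finite_in:
  assumes "locally_finite_in T \<F>"
  shows "closure_preserving_in T \<F>"
  unfolding closure_preserving_in_def
  using assms by (meson closure_of_locally_finite_Union locally_finite_in_subset)

lemma point_finite_in_if_locally_finite_in:
  assumes "locally_finite_in T \<F>"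
  shows "point_finite_in T \<F>"
  unfolding point_finite_in_def
proof
  fix x assume "x \<in> topspace T"
  then obtain V where V: "x \<in> V" "finite {F \<in> \<F>. F \<inter> V \<noteq> {}}"
    using assms unfolding locally_finite_in_def by blast
  have "{F \<in> \<F>. x \<in> F} \<subseteq> {F \<in> \<F>. F \<inter> V \<noteq> {}}" using V(1) by blast
  then show "finite {F \<in> \<F>. x \<in> F}" using V(2) by (rule finite_subset)
qed

theorem theorem2p8:
  fixes T :: "'a::linorder_topology topology"
  assumes "GO_space T"
    and "\<exists>D. sigma_closed_discrete_in (lots_topology :: 'a topology) D \<and>
             lots_topology closure_of D = topspace lots_topology"
  shows "((\<exists>r. monotone_open_locally_finite_operator T r) \<longleftrightarrow> monotonically_metacompact T) \<and>
         (monotonically_metacompact T \<longleftrightarrow> (\<exists>r. monotone_open_closure_preserving_operator T r)) \<and>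
         ((\<exists>r. monotone_open_closure_preserving_operator T r) \<longleftrightarrow>
          (\<exists>r. monotone_closure_preserving_operator T r))"
proof -
  obtain E where E: "GO_tower (\<le>) (<) T E"
    using GO_tower_if_sigma_closed_discrete_dense assms by blast
  \<comment> \<open>Every implication passes through the locally finite operator: the given operator
    only serves to place the one-sided points in a tower, and the new one is built from
    cells.\<close>
  have main: "\<exists>r. monotone_open_locally_finite_operator T r"
    if mono: "monotone_operator T r"
      and controlled: "\<forall>\<U>. open_cover T \<U> \<longrightarrow> locally_controlled_in T (r \<U>)" for r
  proof -
    obtain E' where "exhausting_GO_tower (\<le>) (<) T E'"
      using GO_tower.exhausting_GO_tower_if_controlled_operator[OF E mono controlled] by blast
    then show ?thesis
      using exhausting_GO_tower.monotone_open_locally_finite_operator_first_cell by blast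
  qed
  have cover: "\<Union>(r \<U>) = topspace T" if "monotone_operator T r" "open_cover T \<U>" for r \<U>
    using that unfolding monotone_operator_def by simp
  have from_metacompact: "\<exists>r. monotone_open_locally_finite_operator T r"
    if "monotonically_metacompact T"
  proof -
    from that[unfolded monotonically_metacompact_def]
    obtain r where r: "monotone_operator T r \<and>
      (\<forall>\<U>. open_cover T \<U> \<longrightarrow> point_finite_in T (r \<U>) \<and> open_family T (r \<U>))"
      by (rule exE)
    show ?thesis
      by (rule main[OF r[THEN conjunct1]])
        (use r cover[of r] in \<open>simp add: point_finite_open_cover_locally_controlled\<close>)
  qed
  have from_closure_preserving: "\<exists>r. monotone_open_locally_finite_operator T r"
    if r: "monotone_closure_preserving_operator T r" for r
  proof -
    have mono: "monotone_operator T r"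
      using r by (simp add: monotone_closure_preserving_operator_def)
    show ?thesis
      by (rule main[OF mono])
        (use r cover[OF mono] in \<open>simp add: monotone_closure_preserving_operator_def
          closure_preserving_cover_locally_controlled\<close>)
  qed
  have to_metacompact: "monotonically_metacompact T"
    if "monotone_open_locally_finite_operator T r" for r
    unfolding monotonically_metacompact_def
    by (rule exI[of _ r]) (use that in \<open>simp add: monotone_open_locally_finite_operator_def
      point_finite_in_if_locally_finite_in\<close>)
  have to_closure_preserving: "monotone_open_closure_preserving_operator T r"
    if "monotone_open_locally_finite_operator T r" for r
    using that by (simp add: monotone_open_locally_finite_operator_def
      monotone_open_closure_preserving_operator_def closure_preserving_in_if_locally_finite_in)
  have forget_open: "monotone_closure_preserving_operator T r"
    if "monotone_open_closure_preserving_operator T r" for r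
    using that by (simp add: monotone_open_closure_preserving_operator_def
      monotone_closure_preserving_operator_def)
  show ?thesis
    by (intro conjI iffI; (elim exE)?)
      (meson from_metacompact from_closure_preserving to_metacompact to_closure_preserving
        forget_open)+
qed

end
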